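(* Let $X$ be a compact metric space, $m\in C(X,\mathbb{R}^{d\times d}_{\mathrm{psd}})$ and $M(\xi):=\int_X m(x)\,\mathrm{d}\xi(x)$ for $\xi\in\Xi(X)$. Let $\Psi:\mathbb{R}^{d\times d}_{\mathrm{psd}}\to\mathbb{R}\cup\{\infty\}$ be convex and lower semicontinuous with $\Xi_{\mathrm{fin}}(X)\ne\emptyset$, and suppose that $\Psi|_{\operatorname{dom}\Psi}$ is directionally differentiable w.r.t. $M(\Xi(X))$ with a continuous sensitivity function $\psi:\operatorname{dom}\Psi\times X\to\mathbb{R}$. Let $X^0$ be a finite subset of $X$ with $\Xi_{\mathrm{fin}}(X^0)\neq\emptyset$, and let $(\xi^k)_{k\in K}$ be generated by the strict algorithm without exchange or by the strict algorithm with exchange, with initial discretization $X^0$ and optimality tolerances $\varepsilon=0$ and $\overline{\delta}_k,\underline{\delta}_k\in[0,\infty)$ such that $\lim_{k\to\infty}\overline{\delta}_k=0=\lim_{k\to\infty}\underline{\delta}_k$. In case the algorithm with exchange is used, additionally assume that $\Psi$ is strictly convex and that $(\overline{\delta}_k)$ is summable. (i) If $(\xi^k)$ is terminating, then it terminates at an optimal design for $\Psi\circ M$. (ii) If $(\xi^k)$ is non-terminating, then each of its accumulation points is an optimal design for $\Psi\circ M$. Additionally, if $\Psi$ is strictly convex, then (in the non-terminating case) the sequence of information matrices $(M(\xi^k))$ converges to the unique solution of $\min_{M\in M(\Xi(X))}\Psi(M)$.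
   Context: Let $d\in\mathbb{N}$; $\mathbb{R}^{d\times d}_{\mathrm{psd}}$ is the set of (symmetric) positive semidefinite real $d\times d$ matrices. $\Xi(X)$ is the set of Borel probability measures (designs) on $X$, endowed with the topology of weak convergence (accumulation points refer to this topology); for a finite $X'\subset X$, $\Xi(X')$ is identified with the designs on $X$ supported in $X'$. $\operatorname{supp}\xi$ is the support of $\xi$. $\operatorname{dom}\Psi:=\{M:\Psi(M)<\infty\}$, and for $X'\subset X$, $\Xi_{\mathrm{fin}}(X'):=\{\xi\in\Xi(X'):\Psi(M(\xi))<\infty\}$. Strict convexity of $\Psi$ means that $\operatorname{dom}\Psi$ is convex and the real-valued restriction $\Psi|_{\operatorname{dom}\Psi}$ is strictly convex. A design $\xi^*\in\Xi(X)$ is optimal for $\Psi\circ M$ iff $\Psi(M(\xi^* ))=\inf_{\xi\in\Xi(X)}\Psi(M(\xi))$. A $\delta$-approximate solution of a minimization problem is a feasible point whose objective value is at most the infimum plus $\delta$. A function $\psi:\operatorname{dom}\Psi\times X\to\mathbb{R}$ is a sensitivity function of $\Psi|_{\operatorname{dom}\Psi}$ w.r.t. $M(\Xi(X))$ iff for all $M\in\operatorname{dom}\Psi$ and $\eta\in\Xi(X)$, $\psi(M,\cdot)$ is $\eta$-integrable and $\frac{\Psi(M+t(M(\eta)-M))-\Psi(M)}{t}\to\int_X\psi(M,x)\,\mathrm{d}\eta(x)$ as $t\searrow0$. $\Psi|_{\operatorname{dom}\Psi}$ is directionally differentiable w.r.t. $M(\Xi(X))$ iff such a (necessarily unique) $\psi$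 exists. Strict algorithms. Input: finite $X^0\subset X$, tolerances $\varepsilon,\overline{\delta}_k,\underline{\delta}_k\in[0,\infty)$ ($k\in\mathbb{N}_0$). Start with $k=0$. Step 1: compute a $\overline{\delta}_k$-approximate solution $\xi^k\in\Xi(X^k)$ of $\min_{\xi\in\Xi(X^k)}\Psi(M(\xi))$. Step 2: compute a $\underline{\delta}_k$-approximate solution $x^k\in X$ of $\min_{x\in X}\psi(M(\xi^k),x)$. If $\psi(M(\xi^k),x^k)<-\varepsilon+\underline{\delta}_k$, set $X^{k+1}:=X^k\cup\{x^k\}$ (algorithm without exchange) or $X^{k+1}:=\operatorname{supp}\xi^k\cup\{x^k\}$ (algorithm with exchange) and return to Step 1 with $k+1$ in place of $k$; if $\psi(M(\xi^k),x^k)\ge-\varepsilon+\underline{\delta}_k$, terminate. $K$ is the set of iteration indices: $K=\{0,\dots,k^*\}$ if the algorithm terminates in iteration $k^*$ (then the sequence is said to be terminating, at $\xi^{k^*}$), and $K=\mathbb{N}_0$ if it is non-terminating. *)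

theory Defs
  imports "HOL-Probability.Probability"
begin

section \<open>Minimization problems\<close>

definition minimizers :: "('b \<Rightarrow> ereal) \<Rightarrow> 'b set \<Rightarrow> 'b set" where
  "minimizers f S = {s \<in> S. f s = (INF y\<in>S. f y)}"

definition approx_minimizers :: "real \<Rightarrow> ('b \<Rightarrow> ereal) \<Rightarrow> 'b set \<Rightarrow> 'b set" where
  "approx_minimizers \<delta> f S = {s \<in> S. f s \<le> (INF y\<in>S. f y) + ereal \<delta>}"

section \<open>Design criteria\<close>

definition psd_matrices :: "(real^'d^'d) set" where
  "psd_matrices = {A. transpose A = A \<and> (\<forall>v. 0 \<le> v \<bullet> (A *v v))}"

text \<open>A criterion is a function from the positive semidefinite matrices to the reals extended by
  \<open>\<infinity>\<close>; its values outside \<open>psd_matrices\<close> are irrelevant.\<close>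

definition criterion :: "(real^'d^'d \<Rightarrow> ereal) \<Rightarrow> bool" where
  "criterion \<Psi> \<longleftrightarrow> (\<forall>A\<in>psd_matrices. \<Psi> A \<noteq> - \<infinity>)"

definition crit_dom :: "(real^'d^'d \<Rightarrow> ereal) \<Rightarrow> (real^'d^'d) set" where
  "crit_dom \<Psi> = {A \<in> psd_matrices. \<Psi> A < \<infinity>}"

text \<open>In \<open>ereal\<close>, \<open>0 * \<infinity> = 0\<close>, so the endpoints \<open>u = 0\<close> and \<open>u = 1\<close> below are harmless.\<close>

definition convex_crit :: "(real^'d^'d \<Rightarrow> ereal) \<Rightarrow> bool" where
  "convex_crit \<Psi> \<longleftrightarrow>
     (\<forall>A\<in>psd_matrices. \<forall>B\<in>psd_matrices. \<forall>u\<in>{0..1::real}.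
        \<Psi> (u *\<^sub>R A + (1 - u) *\<^sub>R B) \<le> ereal u * \<Psi> A + ereal (1 - u) * \<Psi> B)"

definition strictly_convex_crit :: "(real^'d^'d \<Rightarrow> ereal) \<Rightarrow> bool" where
  "strictly_convex_crit \<Psi> \<longleftrightarrow>
     convex (crit_dom \<Psi>) \<and>
     (\<forall>A\<in>crit_dom \<Psi>. \<forall>B\<in>crit_dom \<Psi>. \<forall>u\<in>{0<..<1::real}. A \<noteq> B \<longrightarrow>
        \<Psi> (u *\<^sub>R A + (1 - u) *\<^sub>R B) < ereal u * \<Psi> A + ereal (1 - u) * \<Psi> B)"

definition lsc_crit :: "(real^'d^'d \<Rightarrow> ereal) \<Rightarrow> bool" where
  "lsc_crit \<Psi> \<longleftrightarrow> (\<forall>A\<in>psd_matrices. \<Psi> A \<le> Liminf (at A within psd_matrices) \<Psi>)"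

section \<open>Designs\<close>

definition designs :: "'a::metric_space set \<Rightarrow> 'a measure set" where
  "designs X = {\<xi>. prob_space \<xi> \<and> sets \<xi> = sets (restrict_space borel X)}"

definition supp :: "'a::metric_space measure \<Rightarrow> 'a set" where
  "supp \<xi> = {x \<in> space \<xi>. \<forall>U. open U \<and> x \<in> U \<longrightarrow> emeasure \<xi> (U \<inter> space \<xi>) > 0}"

text \<open>For \<open>X' \<subseteq> X\<close>, designs on \<open>X'\<close> are identified with the designs on \<open>X\<close> that are supported
  in \<open>X'\<close>.\<close>

definition designs_in :: "'a::metric_space set \<Rightarrow> 'a set \<Rightarrow> 'a measure set" where
  "designs_in X X' = {\<xi> \<in> designs X. supp \<xi> \<subseteq> X'}"

definition info :: "('a \<Rightarrow> real^'d^'d) \<Rightarrow> 'a measure \<Rightarrow> real^'d^'d" where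
  "info m \<xi> = (LINT x|\<xi>. m x)"

definition fin_designs ::
  "(real^'d^'d \<Rightarrow> ereal) \<Rightarrow> ('a \<Rightarrow> real^'d^'d) \<Rightarrow> 'a::metric_space set \<Rightarrow> 'a set \<Rightarrow> 'a measure set" where
  "fin_designs \<Psi> m X X' = {\<xi> \<in> designs_in X X'. \<Psi> (info m \<xi>) < \<infinity>}"

definition optimal_designs ::
  "(real^'d^'d \<Rightarrow> ereal) \<Rightarrow> ('a \<Rightarrow> real^'d^'d) \<Rightarrow> 'a::metric_space set \<Rightarrow> 'a measure set" where
  "optimal_designs \<Psi> m X = minimizers (\<lambda>\<xi>. \<Psi> (info m \<xi>)) (designs X)"

text \<open>The topology of weak convergence: the coarsest topology on the designs on \<open>X\<close> that makes
  integration of each bounded continuous real function continuous.\<close>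

definition weak_topology :: "'a::metric_space set \<Rightarrow> 'a measure topology" where
  "weak_topology X = topology_generated_by
     {{\<xi> \<in> designs X. (LINT x|\<xi>. f x) \<in> V} | f V.
        continuous_on X (f :: 'a \<Rightarrow> real) \<and> bounded (f ` X) \<and> open V}"

definition accumulation_point_in :: "'b topology \<Rightarrow> (nat \<Rightarrow> 'b) \<Rightarrow> 'b \<Rightarrow> bool" where
  "accumulation_point_in T s p \<longleftrightarrow>
     p \<in> topspace T \<and> (\<forall>U. openin T U \<and> p \<in> U \<longrightarrow> (\<exists>\<^sub>F k in sequentially. s k \<in> U))"

section \<open>Sensitivity functions\<close>

text \<open>The difference quotient is taken in \<open>ereal\<close>, since \<open>A + t (M(\<eta>) - A)\<close> may leave the domain
  of \<open>\<Psi>\<close>; convergence to a real number forces it to be finite for all small \<open>t > 0\<close>.\<close>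

definition sensitivity_function ::
  "(real^'d^'d \<Rightarrow> ereal) \<Rightarrow> ('a \<Rightarrow> real^'d^'d) \<Rightarrow> 'a::metric_space set \<Rightarrow> (real^'d^'d \<Rightarrow> 'a \<Rightarrow> real) \<Rightarrow> bool"
  where
  "sensitivity_function \<Psi> m X \<psi> \<longleftrightarrow>
     (\<forall>A\<in>crit_dom \<Psi>. \<forall>\<eta>\<in>designs X.
        integrable \<eta> (\<psi> A) \<and>
        ((\<lambda>t::real. (\<Psi> (A + t *\<^sub>R (info m \<eta> - A)) - \<Psi> A) / ereal t)
           \<longlongrightarrow> ereal (LINT x|\<eta>. \<psi> A x)) (at_right 0))"

section \<open>Strict adaptive discretization algorithms\<close>

text \<open>A run of the strict algorithm with initial discretization \<open>X0\<close>, optimality tolerance \<open>\<epsilon>\<close>, and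
  tolerances \<open>\<delta>u k\<close> and \<open>\<delta>l k\<close> for the discretized design problems and for the
  minimization of \<open>\<psi> (M(\<xi> k))\<close> over \<open>X\<close>, respectively. \<open>K\<close> is the set of iteration indices,
  \<open>Xs k\<close>, \<open>\<xi> k\<close> and \<open>x k\<close> are the discretization, the design and the point of iteration \<open>k \<in> K\<close>;
  these sequences are unconstrained at indices outside \<open>K\<close>. The flag \<open>exch\<close> selects the
  algorithm with exchange.\<close>

definition strict_run ::
  "bool \<Rightarrow> (real^'d^'d \<Rightarrow> ereal) \<Rightarrow> (real^'d^'d \<Rightarrow> 'a \<Rightarrow> real) \<Rightarrow> ('a \<Rightarrow> real^'d^'d) \<Rightarrow>
   'a::metric_space set \<Rightarrow> 'a set \<Rightarrow> real \<Rightarrow> (nat \<Rightarrow> real) \<Rightarrow> (nat \<Rightarrow> real) \<Rightarrow>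
   nat set \<Rightarrow> (nat \<Rightarrow> 'a set) \<Rightarrow> (nat \<Rightarrow> 'a measure) \<Rightarrow> (nat \<Rightarrow> 'a) \<Rightarrow> bool" where
  "strict_run exch \<Psi> \<psi> m X X0 \<epsilon> \<delta>u \<delta>l K Xs \<xi> x \<longleftrightarrow>
     (K = UNIV \<or> (\<exists>n. K = {..n})) \<and>
     Xs 0 = X0 \<and>
     (\<forall>k\<in>K.
        \<xi> k \<in> approx_minimizers (\<delta>u k) (\<lambda>\<eta>. \<Psi> (info m \<eta>)) (designs_in X (Xs k)) \<and>
        x k \<in> approx_minimizers (\<delta>l k) (\<lambda>y. ereal (\<psi> (info m (\<xi> k)) y)) X \<and>
        (if \<psi> (info m (\<xi> k)) (x k) < - \<epsilon> + \<delta>l k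
         then Suc k \<in> K \<and> Xs (Suc k) = (if exch then supp (\<xi> k) else Xs k) \<union> {x k}
         else K = {..k}))"

end

theory Submission
  imports Defs
begin

text \<open>Write \<open>M\<^sub>k\<close> for the information matrix of the \<open>k\<close>-th design of a run. By convexity of the
  criterion, \<open>\<Psi> A + \<integral> \<psi> A d\<eta> \<le> \<Psi> (M(\<eta>))\<close> for all \<open>A\<close> in the domain and all designs \<open>\<eta>\<close>
  (\<open>sensitivity_subgradient\<close>). Hence a matrix in the domain whose sensitivity is nonnegative on \<open>X\<close>
  is at least as good as every information matrix. A run stops only if the sensitivity at \<open>M\<^sub>k\<close> is
  nonnegative on \<open>X\<close>, which settles terminating runs.

  For a run that does not terminate, the same test is applied at an arbitrary cluster point \<open>A\<close>
  of \<open>(M\<^sub>k)\<close>. Suppose that \<open>\<psi> A\<close> is negative somewhere. Continuity of \<open>\<psi>\<close> and compactness of \<open>X\<close>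
  give a constant \<open>c > 0\<close> and a neighbourhood of \<open>A\<close> such that for all large \<open>k\<close> with \<open>M\<^sub>k\<close> close
  to \<open>A\<close>, the sensitivity towards the chosen point \<open>x\<^sub>k\<close> is below \<open>-c\<close> on the whole part of the domain
  in that neighbourhood. Moving from \<open>M\<^sub>k\<close> towards \<open>m(x\<^sub>k)\<close> by a step length \<open>T\<close> that does not depend
  on \<open>k\<close> therefore lowers the criterion by at least \<open>c T\<close> (\<open>descent_along_segment\<close>; lower
  semicontinuity is what prevents the segment from leaving the domain). The matrix reached in this way
  belongs to a mixture of the \<open>k\<close>-th design and the point mass at \<open>x\<^sub>k\<close>. With or without exchange,
  this mixture is feasible in iteration \<open>k + 1\<close>, so that
  \<open>\<Psi> (M\<^bsub>k+1\<^esub>) \<le> \<Psi> (M\<^sub>k) - c T + \<delta>\<^bsub>k+1\<^esub>\<close> for infinitely many \<open>k\<close>.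
  But the values \<open>\<Psi> (M\<^sub>k)\<close> converge (\<open>crit_val_convergent\<close>): they are bounded below, and they are
  decreasing up to the tolerances, because the discretizations grow in the algorithm without exchange
  and because the tolerances are summable in the algorithm with exchange. This is a contradiction
  (\<open>cluster_point_nonneg_sensitivity\<close>).

  Taking information matrices is weakly continuous, so accumulation points of the designs yield cluster
  points of \<open>(M\<^sub>k)\<close>. The set of all information matrices is the convex hull of \<open>m(X)\<close>, which is
  compact; under strict convexity the minimizer on it is unique, so \<open>(M\<^sub>k)\<close> has just one cluster
  point in a compact set and converges to it.\<close>

section \<open>Minimizers and convergence of sequences\<close>

lemma minimizers_iff: "s \<in> minimizers f S \<longleftrightarrow> s \<in> S \<and> (\<forall>y\<in>S. f s \<le> f y)"
proof -
  have "f s = (INF y\<in>S. f y)" if "s \<in> S" "\<forall>y\<in>S. f s \<le> f y"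
    using that by (intro antisym INF_greatest INF_lower) auto
  then show ?thesis unfolding minimizers_def using INF_lower[of _ S f] by auto
qed

lemma approx_minimizers_le:
  "s \<in> approx_minimizers \<delta> f S \<Longrightarrow> y \<in> S \<Longrightarrow> f s \<le> f y + ereal \<delta>"
  unfolding approx_minimizers_def
  using add_right_mono[OF INF_lower[of y S f], of "ereal \<delta>"] order_trans by blast

text \<open>The limit is the infimum: once \<open>a i\<close> is close to it, so are all later terms, up to the error \<open>d\<close>.\<close>

lemma convergent_almost_decreasing:
  fixes a d :: "nat \<Rightarrow> real"
  assumes le: "\<And>i j. i \<le> j \<Longrightarrow> a j \<le> a i + d j" and d: "d \<longlonglongrightarrow> 0" and bdd: "\<And>k. b \<le> a k"
  shows "convergent a"
proof -
  define l where "l = Inf (range a)"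
  have bb: "bdd_below (range a)" using bdd by (intro bdd_belowI[of _ b]) auto
  have lower: "l \<le> a k" for k unfolding l_def using bb by (intro cInf_lower) auto
  have "a \<longlonglongrightarrow> l"
  proof (rule order_tendstoI)
    fix z assume "z < l"
    then show "\<forall>\<^sub>F k in sequentially. z < a k" using lower by (intro always_eventually) (auto intro: less_le_trans)
  next
    fix z assume "l < z"
    then obtain i where i: "a i < z"
      unfolding l_def using cInf_less_iff[of "range a" z] bb by auto
    have "\<forall>\<^sub>F j in sequentially. d j < z - a i" using d i by (intro order_tendstoD(2)) auto
    with eventually_ge_at_top[of i] show "\<forall>\<^sub>F j in sequentially. a j < z"
    proof eventually_elim
      case (elim j)
      with le[of i j] show ?case by linarith
    qed
  qed
  then show ?thesis by (auto simp: convergent_def)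
qed

text \<open>Subtracting the accumulated errors leaves a decreasing sequence.\<close>

lemma convergent_summable_increase:
  fixes a d :: "nat \<Rightarrow> real"
  assumes le: "\<And>k. a (Suc k) \<le> a k + d (Suc k)" and d: "summable d" "\<And>k. 0 \<le> d k" and bdd: "\<And>k. b \<le> a k"
  shows "convergent a"
proof -
  define s where "s k = a k - (\<Sum>i<Suc k. d i)" for k
  have "s (Suc k) \<le> s k" for k using le[of k] by (simp add: s_def)
  then have "decseq s" by (rule decseq_SucI)
  moreover have "b - suminf d \<le> s k" for k
    using bdd[of k] sum_le_suminf[OF d(1), of "{..<Suc k}"] d(2) by (simp add: s_def)
  ultimately obtain l where "s \<longlonglongrightarrow> l" by (metis decseq_convergent)
  moreover have "(\<lambda>k. \<Sum>i<Suc k. d i) \<longlonglongrightarrow> suminf d"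
    by (intro LIMSEQ_Suc summable_LIMSEQ d)
  ultimately have "(\<lambda>k. s k + (\<Sum>i<Suc k. d i)) \<longlonglongrightarrow> l + suminf d" by (rule tendsto_add)
  then show ?thesis by (auto simp: s_def convergent_def)
qed

text \<open>The conclusion is phrased by neighbourhoods rather than by a convergent subsequence, because this is
  also the form in which accumulation points of the designs arrive.\<close>

lemma frequently_in_compact_cluster:
  fixes s :: "nat \<Rightarrow> 'b::topological_space"
  assumes S: "compact S" and freq: "\<exists>\<^sub>F k in sequentially. s k \<in> S"
  shows "\<exists>B\<in>S. \<forall>U. open U \<longrightarrow> B \<in> U \<longrightarrow> (\<exists>\<^sub>F k in sequentially. s k \<in> U)"
proof -
  define F where "F = filtermap s (inf sequentially (principal {k. s k \<in> S}))"
  have "F \<noteq> bot"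
    using freq unfolding F_def trivial_limit_def eventually_filtermap eventually_inf_principal frequently_def
    by simp
  moreover have "eventually (\<lambda>B. B \<in> S) F"
    by (simp add: F_def eventually_filtermap eventually_inf_principal)
  ultimately obtain B where B: "B \<in> S" "inf (nhds B) F \<noteq> bot" using S unfolding compact_filter by blast
  have "\<exists>\<^sub>F k in sequentially. s k \<in> U" if U: "open U" "B \<in> U" for U
  proof (rule ccontr)
    assume "\<not> (\<exists>\<^sub>F k in sequentially. s k \<in> U)"
    then have "\<forall>\<^sub>F k in sequentially. s k \<notin> U" by (simp add: not_frequently)
    then have "eventually (\<lambda>A. A \<notin> U) F"
      unfolding F_def eventually_filtermap eventually_inf_principal by (rule eventually_mono) simp
    moreover have "eventually (\<lambda>A. A \<in> U) (nhds B)" using U by (rule eventually_nhds_in_open)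
    ultimately have "eventually (\<lambda>_. False) (inf (nhds B) F)" unfolding eventually_inf by blast
    with B(2) show False unfolding trivial_limit_def by blast
  qed
  with B(1) show ?thesis by blast
qed

section \<open>Designs and their information matrices\<close>

lemma prob_space_design: "\<eta> \<in> designs X \<Longrightarrow> prob_space \<eta>"
  by (simp add: designs_def)

lemma sets_design: "\<eta> \<in> designs X \<Longrightarrow> sets \<eta> = sets (restrict_space borel X)"
  by (simp add: designs_def)

lemma space_design: "\<eta> \<in> designs X \<Longrightarrow> space \<eta> = X"
  using sets_eq_imp_space_eq[OF sets_design] by (simp add: space_restrict_space)

lemma measurable_on_design:
  fixes f :: "'a::metric_space \<Rightarrow> 'b::euclidean_space"
  assumes "continuous_on X f" "\<eta> \<in> designs X"
  shows "f \<in> borel_measurable \<eta>"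
  using borel_measurable_continuous_on_restrict[OF assms(1)] measurable_cong_sets[OF sets_design[OF assms(2)] refl]
  by blast

lemma bounded_on_compact:
  fixes f :: "'a::metric_space \<Rightarrow> 'b::euclidean_space"
  assumes "compact X" "continuous_on X f"
  shows "\<exists>B. \<forall>x\<in>X. norm (f x) \<le> B"
  using compact_imp_bounded[OF compact_continuous_image[OF assms(2,1)]] unfolding bounded_iff by blast

lemma integrable_on_design:
  fixes f :: "'a::metric_space \<Rightarrow> 'b::euclidean_space"
  assumes "compact X" "continuous_on X f" "\<eta> \<in> designs X"
  shows "integrable \<eta> f"
proof -
  interpret prob_space \<eta> using assms(3) by (rule prob_space_design)
  obtain B where "\<And>x. x \<in> X \<Longrightarrow> norm (f x) \<le> B" using bounded_on_compact[OF assms(1,2)] by blast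
  then have "AE x in \<eta>. norm (f x) \<le> B"
    by (intro AE_I2) (metis space_design[OF assms(3)])
  then show ?thesis
    by (rule integrable_const_bound[OF _ measurable_on_design[OF assms(2,3)]])
qed

definition dirac_design :: "'a::metric_space set \<Rightarrow> 'a \<Rightarrow> 'a measure" where
  "dirac_design X y = return (restrict_space borel X) y"

lemma dirac_design_in_designs: "y \<in> X \<Longrightarrow> dirac_design X y \<in> designs X"
  unfolding designs_def dirac_design_def mem_Collect_eq
  by (intro conjI prob_space_return sets_return) (simp add: space_restrict_space)

lemma integral_dirac_design:
  fixes f :: "'a::metric_space \<Rightarrow> 'b::euclidean_space"
  assumes "y \<in> X" "f \<in> borel_measurable (dirac_design X y)"
  shows "(LINT x|dirac_design X y. f x) = f y"
  unfolding dirac_design_def using assms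
  by (intro integral_return) (auto simp: space_restrict_space dirac_design_def)

text \<open>The complement of \<open>{y}\<close> is an open null set.\<close>

lemma supp_dirac_design: "supp (dirac_design X y) \<subseteq> {y}"
proof
  fix x assume x: "x \<in> supp (dirac_design X y)"
  have "open (- {y})" by auto
  moreover have "emeasure (dirac_design X y) (- {y} \<inter> X) = 0"
    unfolding dirac_design_def by (subst emeasure_return) (auto simp: sets_restrict_space)
  ultimately show "x \<in> {y}"
    using x unfolding supp_def by (auto simp: dirac_design_def space_restrict_space)
qed

text \<open>The convex combination \<open>t \<eta> + (1 - t) \<xi>\<close>, as the law of a sample that is drawn from \<open>\<eta>\<close> with
  probability \<open>t\<close> and from \<open>\<xi>\<close> otherwise. This makes the integration theory of the Giry monad available.\<close>

definition mixture :: "real \<Rightarrow> 'a measure \<Rightarrow> 'a measure \<Rightarrow> 'a measure" where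
  "mixture t \<eta> \<xi> = measure_pmf (bernoulli_pmf t) \<bind> (\<lambda>b. if b then \<eta> else \<xi>)"

lemma mixture_kernel:
  assumes "\<eta> \<in> designs X" "\<xi> \<in> designs X"
  shows "(\<lambda>b. if b then \<eta> else \<xi>)
    \<in> measurable (measure_pmf (bernoulli_pmf t)) (subprob_algebra (restrict_space borel X))"
proof -
  have "\<nu> \<in> space (subprob_algebra (restrict_space borel X))" if "\<nu> \<in> designs X" for \<nu>
    using prob_space_imp_subprob_space[OF prob_space_design[OF that]] sets_design[OF that]
    unfolding space_subprob_algebra by blast
  then show ?thesis using assms unfolding measurable_pmf_measure1 by simp
qed

lemma mixture_in_designs:
  assumes "\<eta> \<in> designs X" "\<xi> \<in> designs X"
  shows "mixture t \<eta> \<xi> \<in> designs X"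
proof -
  have "prob_space (mixture t \<eta> \<xi>)"
    unfolding mixture_def
    by (rule prob_space.prob_space_bind[OF measure_pmf.prob_space_axioms _ mixture_kernel[OF assms]])
      (use assms in \<open>simp add: prob_space_design\<close>)
  moreover have "sets (mixture t \<eta> \<xi>) = sets (restrict_space borel X)"
    unfolding mixture_def by (rule sets_bind) (use assms in \<open>simp_all add: sets_design\<close>)
  ultimately show ?thesis unfolding designs_def by blast
qed

lemma emeasure_mixture:
  assumes "\<eta> \<in> designs X" "\<xi> \<in> designs X" "t \<in> {0..1}" "S \<in> sets (restrict_space borel X)"
  shows "emeasure (mixture t \<eta> \<xi>) S = emeasure \<eta> S * ennreal t + emeasure \<xi> S * ennreal (1 - t)"
  unfolding mixture_def using assms(3)
  by (subst emeasure_bind[OF _ mixture_kernel[OF assms(1,2)] assms(4)]) auto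

text \<open>A point outside both supports has a null neighbourhood for each of the two designs; their intersection
  is null for the mixture.\<close>

lemma supp_mixture_subset:
  assumes "\<eta> \<in> designs X" "\<xi> \<in> designs X" "t \<in> {0..1}"
  shows "supp (mixture t \<eta> \<xi>) \<subseteq> supp \<eta> \<union> supp \<xi>"
proof
  fix x assume x: "x \<in> supp (mixture t \<eta> \<xi>)"
  note sp = space_design[OF assms(1)] space_design[OF assms(2)]
    space_design[OF mixture_in_designs[OF assms(1,2)]]
  have xX: "x \<in> X" using x by (simp add: supp_def sp)
  show "x \<in> supp \<eta> \<union> supp \<xi>"
  proof (rule ccontr)
    assume "x \<notin> supp \<eta> \<union> supp \<xi>"
    then obtain U V where U: "open U" "x \<in> U" "emeasure \<eta> (U \<inter> X) = 0"
      and V: "open V" "x \<in> V" "emeasure \<xi> (V \<inter> X) = 0"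
      using xX by (auto simp: supp_def sp)
    have m: "W \<inter> X \<in> sets (restrict_space borel X)" if "open W" for W
      using that by (auto simp: sets_restrict_space)
    have "emeasure \<eta> ((U \<inter> V) \<inter> X) \<le> emeasure \<eta> (U \<inter> X)" "emeasure \<xi> ((U \<inter> V) \<inter> X) \<le> emeasure \<xi> (V \<inter> X)"
      using m U(1) V(1) by (auto intro!: emeasure_mono simp: sets_design[OF assms(1)] sets_design[OF assms(2)])
    then have "emeasure (mixture t \<eta> \<xi>) ((U \<inter> V) \<inter> X) = 0"
      using U V by (subst emeasure_mixture[OF assms]) (auto intro: m)
    moreover have "emeasure (mixture t \<eta> \<xi>) ((U \<inter> V) \<inter> X) > 0"
      using x U V unfolding supp_def sp by (auto intro: open_Int)
    ultimately show False by simp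
  qed
qed

lemma integral_mixture:
  fixes f :: "'a::metric_space \<Rightarrow> 'b::euclidean_space"
  assumes X: "compact X" and f: "continuous_on X f"
    and d: "\<eta> \<in> designs X" "\<xi> \<in> designs X" and t: "t \<in> {0..1}"
  shows "(LINT x|mixture t \<eta> \<xi>. f x) = t *\<^sub>R (LINT x|\<eta>. f x) + (1 - t) *\<^sub>R (LINT x|\<xi>. f x)"
proof (rule euclidean_eqI)
  fix i :: 'b assume "i \<in> Basis"
  have fi: "continuous_on X (\<lambda>x. f x \<bullet> i)" using f by (intro continuous_intros)
  obtain B where B: "\<And>x. x \<in> X \<Longrightarrow> norm (f x \<bullet> i) \<le> B"
    using bounded_on_compact[OF X fi] by blast
  have inner: "(LINT x|\<nu>. f x) \<bullet> i = (LINT x|\<nu>. f x \<bullet> i)" if "\<nu> \<in> designs X" for \<nu>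
    using integrable_on_design[OF X f that] by simp
  have "(LINT x|mixture t \<eta> \<xi>. f x \<bullet> i)
      = (LINT b|measure_pmf (bernoulli_pmf t). LINT x|(if b then \<eta> else \<xi>). f x \<bullet> i)"
    unfolding mixture_def
    using B d prob_space.emeasure_space_1[OF prob_space_design[OF d(1)]]
      prob_space.emeasure_space_1[OF prob_space_design[OF d(2)]]
    by (intro integral_bind[OF borel_measurable_continuous_on_restrict[OF fi] _ mixture_kernel[OF d],
          where B = B and B' = 1])
      (auto simp: space_restrict_space measure_pmf.finite_measure_axioms)
  also have "\<dots> = t * (LINT x|\<eta>. f x \<bullet> i) + (1 - t) * (LINT x|\<xi>. f x \<bullet> i)"
    using t by simp
  finally show "(LINT x|mixture t \<eta> \<xi>. f x) \<bullet> i
      = (t *\<^sub>R (LINT x|\<eta>. f x) + (1 - t) *\<^sub>R (LINT x|\<xi>. f x)) \<bullet> i"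
    by (simp add: inner[OF d(1)] inner[OF d(2)] inner[OF mixture_in_designs[OF d]] inner_add_left)
qed

lemma convex_psd_matrices: "convex (psd_matrices :: (real^'d^'d) set)"
proof (rule convexI)
  fix A B :: "real^'d^'d" and u v :: real
  assume A: "A \<in> psd_matrices" and B: "B \<in> psd_matrices" and uv: "0 \<le> u" "0 \<le> v"
  have "w \<bullet> ((u *\<^sub>R A + v *\<^sub>R B) *v w) = u * (w \<bullet> (A *v w)) + v * (w \<bullet> (B *v w))" for w
    by (simp add: matrix_vector_mult_add_rdistrib scaleR_matrix_vector_assoc[symmetric] inner_add_right)
  moreover have "transpose (u *\<^sub>R A + v *\<^sub>R B) = u *\<^sub>R transpose A + v *\<^sub>R transpose B"
    by (simp add: transpose_def vec_eq_iff)
  ultimately show "u *\<^sub>R A + v *\<^sub>R B \<in> psd_matrices"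
    using A B uv by (simp add: psd_matrices_def)
qed

locale design_space =
  fixes X :: "'a::metric_space set" and m :: "'a \<Rightarrow> real^'d^'d"
  assumes compact_X: "compact X" and continuous_m: "continuous_on X m"
    and m_psd: "m ` X \<subseteq> psd_matrices"
begin

lemma info_dirac: "y \<in> X \<Longrightarrow> info m (dirac_design X y) = m y"
  unfolding info_def
  by (rule integral_dirac_design) (auto intro: measurable_on_design continuous_m dirac_design_in_designs)

lemma info_mixture:
  assumes "\<eta> \<in> designs X" "\<xi> \<in> designs X" "t \<in> {0..1}"
  shows "info m (mixture t \<eta> \<xi>) = t *\<^sub>R info m \<eta> + (1 - t) *\<^sub>R info m \<xi>"
  unfolding info_def by (rule integral_mixture[OF compact_X continuous_m assms])

lemma compact_hull: "compact (convex hull (m ` X))"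
  by (intro compact_convex_hull compact_continuous_image continuous_m compact_X)

text \<open>Otherwise a hyperplane would strictly separate the mean of \<open>m\<close> from all values of \<open>m\<close>.\<close>

lemma info_in_hull:
  assumes \<eta>: "\<eta> \<in> designs X"
  shows "info m \<eta> \<in> convex hull (m ` X)"
proof (rule ccontr)
  assume "info m \<eta> \<notin> convex hull (m ` X)"
  from separating_hyperplane_closed_point[OF convex_convex_hull compact_imp_closed[OF compact_hull] this]
  obtain a b where ab: "a \<bullet> info m \<eta> < b" "\<And>B. B \<in> convex hull (m ` X) \<Longrightarrow> a \<bullet> B > b"
    by blast
  have i: "integrable \<eta> m" by (rule integrable_on_design[OF compact_X continuous_m \<eta>])
  have "b \<le> (LINT x|\<eta>. a \<bullet> m x)"
    using ab(2) i
    by (intro prob_space.integral_ge_const prob_space_design[OF \<eta>])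
      (auto simp: space_design[OF \<eta>] hull_inc less_imp_le intro!: AE_I2)
  with ab(1) show False using i by (simp add: info_def)
qed

lemma info_image_eq_hull: "info m ` designs X = convex hull (m ` X)"
proof
  show "info m ` designs X \<subseteq> convex hull (m ` X)" using info_in_hull by blast
  have "convex (info m ` designs X)"
    unfolding convex_alt
  proof (clarsimp)
    fix \<eta> \<xi> and u :: real assume "\<eta> \<in> designs X" "\<xi> \<in> designs X" "0 \<le> u" "u \<le> 1"
    then show "(1 - u) *\<^sub>R info m \<eta> + u *\<^sub>R info m \<xi> \<in> info m ` designs X"
      using info_mixture[of \<xi> \<eta> u] mixture_in_designs[of \<xi> X \<eta> u] by (metis add.commute atLeastAtMost_iff imageI)
  qed
  moreover have "m ` X \<subseteq> info m ` designs X"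
    by (rule image_subsetI, subst info_dirac[symmetric])
      (assumption, rule imageI, rule dirac_design_in_designs)
  ultimately show "convex hull (m ` X) \<subseteq> info m ` designs X" by (intro hull_minimal)
qed

lemma hull_psd: "convex hull (m ` X) \<subseteq> psd_matrices"
  by (intro hull_minimal m_psd convex_psd_matrices)

lemma info_psd: "\<eta> \<in> designs X \<Longrightarrow> info m \<eta> \<in> psd_matrices"
  using info_in_hull hull_psd by blast

text \<open>Testing against the coordinates of \<open>m\<close>, which are bounded continuous functions, shows that \<open>info m\<close> is
  continuous for the weak topology; boxes suffice for the application to cluster points.\<close>

lemma openin_weak_topology_info_box:
  "openin (weak_topology X) {\<eta> \<in> designs X. info m \<eta> \<in> box a b}"
proof -
  define W where "W i = {\<eta> \<in> designs X. (LINT x|\<eta>. m x \<bullet> i) \<in> {a \<bullet> i <..< b \<bullet> i}}" for i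
  have "openin (weak_topology X) (W i)" for i
  proof -
    have c: "continuous_on X (\<lambda>x. m x \<bullet> i)" using continuous_m by (intro continuous_intros)
    have "bounded ((\<lambda>x. m x \<bullet> i) ` X)"
      by (intro compact_imp_bounded compact_continuous_image c compact_X)
    with c show ?thesis
      unfolding weak_topology_def W_def
      by (intro topology_generated_by_Basis CollectI exI[of _ "\<lambda>x. m x \<bullet> i"]
            exI[of _ "{a \<bullet> i <..< b \<bullet> i}"] conjI refl open_greaterThanLessThan)
  qed
  then have "openin (weak_topology X) (\<Inter>i\<in>Basis. W i)" by (intro openin_INT2) auto
  moreover have "(\<Inter>i\<in>Basis. W i) = {\<eta> \<in> designs X. info m \<eta> \<in> box a b}"
  proof -
    have "info m \<eta> \<bullet> i = (LINT x|\<eta>. m x \<bullet> i)" if "\<eta> \<in> designs X" for \<eta> i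
      using integrable_on_design[OF compact_X continuous_m that] by (simp add: info_def)
    then have W: "\<eta> \<in> W i \<longleftrightarrow> \<eta> \<in> designs X \<and> a \<bullet> i < info m \<eta> \<bullet> i \<and> info m \<eta> \<bullet> i < b \<bullet> i" for \<eta> i
      by (auto simp: W_def)
    show ?thesis using SOME_Basis by (fastforce simp: W mem_box)
  qed
  ultimately show ?thesis by simp
qed

lemma accumulation_point_info:
  assumes acc: "accumulation_point_in (weak_topology X) \<xi> \<xi>'"
  shows "\<xi>' \<in> designs X"
    and "open U \<Longrightarrow> info m \<xi>' \<in> U \<Longrightarrow> \<exists>\<^sub>F k in sequentially. info m (\<xi> k) \<in> U"
proof -
  show d: "\<xi>' \<in> designs X"
    using acc by (auto simp: accumulation_point_in_def weak_topology_def)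
  assume "open U" "info m \<xi>' \<in> U"
  then obtain a b where ab: "box a b \<subseteq> U" "info m \<xi>' \<in> box a b" by (rule open_contains_box)
  have "\<exists>\<^sub>F k in sequentially. \<xi> k \<in> {\<eta> \<in> designs X. info m \<eta> \<in> box a b}"
    using acc d ab(2) openin_weak_topology_info_box unfolding accumulation_point_in_def by blast
  then show "\<exists>\<^sub>F k in sequentially. info m (\<xi> k) \<in> U"
    by (rule frequently_elim1) (use ab(1) in blast)
qed

end

section \<open>Descent along segments\<close>

lemma convex_point_on_segment: "convex S \<Longrightarrow> A \<in> S \<Longrightarrow> B \<in> S \<Longrightarrow> t \<in> {0..1::real} \<Longrightarrow> A + t *\<^sub>R (B - A) \<in> S"
  using convexD_alt[of S A B t] by (simp add: algebra_simps)

locale design_problem = design_space X m for X :: "'a::metric_space set" and m :: "'a \<Rightarrow> real^'d^'d" +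
  fixes \<Psi> :: "real^'d^'d \<Rightarrow> ereal" and \<psi> :: "real^'d^'d \<Rightarrow> 'a \<Rightarrow> real"
  assumes criterion: "criterion \<Psi>" and convex_criterion: "convex_crit \<Psi>" and lsc: "lsc_crit \<Psi>"
    and sensitivity: "sensitivity_function \<Psi> m X \<psi>"
    and continuous_sensitivity: "continuous_on (crit_dom \<Psi> \<times> X) (\<lambda>(A, y). \<psi> A y)"
begin

text \<open>Real values of the criterion, meaningful on its domain only; they keep the estimates out of \<open>ereal\<close>.\<close>

definition crit_val :: "real^'d^'d \<Rightarrow> real" where
  "crit_val A = real_of_ereal (\<Psi> A)"

lemma crit_val: "A \<in> crit_dom \<Psi> \<Longrightarrow> \<Psi> A = ereal (crit_val A)"
  using criterion unfolding crit_val_def crit_dom_def criterion_def by (cases "\<Psi> A") auto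

lemma crit_dom_psd: "A \<in> crit_dom \<Psi> \<Longrightarrow> A \<in> psd_matrices"
  by (simp add: crit_dom_def)

lemma crit_domI: "A \<in> psd_matrices \<Longrightarrow> \<Psi> A \<le> ereal c \<Longrightarrow> A \<in> crit_dom \<Psi>"
  unfolding crit_dom_def using order_le_less_trans[of "\<Psi> A" "ereal c" \<infinity>] by simp

text \<open>Lower semicontinuity is given by punctured neighbourhoods; since \<open>A\<close> itself satisfies the strict
  inequality, full neighbourhoods may be used.\<close>

lemma superlevel_neighbourhood:
  assumes A: "A \<in> psd_matrices" and c: "c < \<Psi> A"
  obtains U where "open U" "A \<in> U" "\<And>B. B \<in> U \<Longrightarrow> B \<in> psd_matrices \<Longrightarrow> c < \<Psi> B"
proof -
  have "c < Liminf (at A within psd_matrices) \<Psi>"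
    using lsc A c unfolding lsc_crit_def by (meson less_le_trans)
  then have "\<forall>\<^sub>F B in at A within psd_matrices. c < \<Psi> B" by (rule less_LiminfD)
  then obtain U where "open U" "A \<in> U" "\<forall>B\<in>U. B \<noteq> A \<longrightarrow> B \<in> psd_matrices \<longrightarrow> c < \<Psi> B"
    unfolding eventually_at_topological by blast
  with c show ?thesis by (intro that[of U]) auto
qed

text \<open>By lower semicontinuity, a bound on the criterion along the sequence passes to its cluster points.\<close>

lemma limit_in_dom:
  assumes A: "A \<in> psd_matrices"
    and le: "\<And>k. Mk k \<in> psd_matrices" "\<And>k. \<Psi> (Mk k) \<le> ereal c"
    and clust: "\<And>U. open U \<Longrightarrow> A \<in> U \<Longrightarrow> \<exists>\<^sub>F k in sequentially. Mk k \<in> U"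
  shows "A \<in> crit_dom \<Psi>"
proof -
  have "\<Psi> A \<le> ereal c"
  proof (rule ccontr)
    assume "\<not> \<Psi> A \<le> ereal c"
    then have "ereal c < \<Psi> A" by simp
    then obtain U where U: "open U" "A \<in> U" "\<And>B. B \<in> U \<Longrightarrow> B \<in> psd_matrices \<Longrightarrow> ereal c < \<Psi> B"
      using superlevel_neighbourhood[OF A] by blast
    obtain k where "Mk k \<in> U" using frequently_ex[OF clust[OF U(1,2)]] by blast
    with U(3) le show False by (meson leD)
  qed
  then show ?thesis using A by (rule crit_domI[rotated])
qed

lemma sensitivity_design:
  assumes "A \<in> crit_dom \<Psi>" "\<eta> \<in> designs X"
  shows "integrable \<eta> (\<psi> A)"
    and "((\<lambda>t::real. (\<Psi> (A + t *\<^sub>R (info m \<eta> - A)) - \<Psi> A) / ereal t)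
           \<longlongrightarrow> ereal (LINT x|\<eta>. \<psi> A x)) (at_right 0)"
  using sensitivity assms unfolding sensitivity_function_def by blast+

lemma continuous_sensitivity_section:
  assumes "A \<in> crit_dom \<Psi>"
  shows "continuous_on X (\<psi> A)"
proof -
  have "continuous_on X (\<lambda>y. (A, y))"
    by (intro continuous_on_Pair continuous_on_const continuous_on_id)
  from continuous_on_compose2[OF continuous_sensitivity this] assms show ?thesis by auto
qed

text \<open>Convexity bounds every difference quotient with \<open>0 < t < 1\<close> by \<open>\<Psi> (M(\<eta>)) - \<Psi> A\<close>, and the
  quotients tend to the integral of the sensitivity.\<close>

lemma sensitivity_subgradient:
  assumes A: "A \<in> crit_dom \<Psi>" and \<eta>: "\<eta> \<in> designs X"
  shows "\<Psi> A + ereal (LINT x|\<eta>. \<psi> A x) \<le> \<Psi> (info m \<eta>)"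
proof (cases "info m \<eta> \<in> crit_dom \<Psi>")
  case False
  then have "\<Psi> (info m \<eta>) = \<infinity>" using info_psd[OF \<eta>] by (simp add: crit_dom_def)
  then show ?thesis by simp
next
  case True
  define a b where "a = crit_val A" and "b = crit_val (info m \<eta>)"
  have ab: "\<Psi> A = ereal a" "\<Psi> (info m \<eta>) = ereal b"
    using crit_val A True by (auto simp: a_def b_def)
  have "\<forall>\<^sub>F t in at_right (0::real). (\<Psi> (A + t *\<^sub>R (info m \<eta> - A)) - \<Psi> A) / ereal t \<le> ereal (b - a)"
    unfolding eventually_at_right_field
  proof (intro exI[of _ 1] conjI allI impI)
    fix t :: real assume t: "0 < t" "t < 1"
    have "\<Psi> (t *\<^sub>R info m \<eta> + (1 - t) *\<^sub>R A) \<le> ereal t * \<Psi> (info m \<eta>) + ereal (1 - t) * \<Psi> A"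
      using convex_criterion info_psd[OF \<eta>] crit_dom_psd[OF A] t unfolding convex_crit_def by auto
    also have "t *\<^sub>R info m \<eta> + (1 - t) *\<^sub>R A = A + t *\<^sub>R (info m \<eta> - A)" by (simp add: algebra_simps)
    finally have le: "\<Psi> (A + t *\<^sub>R (info m \<eta> - A)) \<le> ereal (t * b + (1 - t) * a)" by (simp add: ab)
    show "(\<Psi> (A + t *\<^sub>R (info m \<eta> - A)) - \<Psi> A) / ereal t \<le> ereal (b - a)"
    proof (cases "\<Psi> (A + t *\<^sub>R (info m \<eta> - A))")
      case (real r)
      then show ?thesis using le t by (simp add: ab field_simps)
    next
      case MInf
      then show ?thesis using t by (simp add: ab divide_ereal_def)
    qed (use le in auto)
  qed simp
  with sensitivity_design(2)[OF A \<eta>] have "ereal (LINT x|\<eta>. \<psi> A x) \<le> ereal (b - a)"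
    by (intro tendsto_upperbound) auto
  then show ?thesis by (simp add: ab)
qed

lemma nonneg_sensitivity_imp_minimal:
  assumes A: "A \<in> crit_dom \<Psi>" and nn: "\<And>y. y \<in> X \<Longrightarrow> 0 \<le> \<psi> A y" and \<eta>: "\<eta> \<in> designs X"
  shows "\<Psi> A \<le> \<Psi> (info m \<eta>)"
proof -
  have "0 \<le> (LINT x|\<eta>. \<psi> A x)"
    using nn by (intro integral_nonneg_AE AE_I2) (simp add: space_design[OF \<eta>])
  then have "\<Psi> A + 0 \<le> \<Psi> A + ereal (LINT x|\<eta>. \<psi> A x)" by (intro add_left_mono) simp
  also note sensitivity_subgradient[OF A \<eta>]
  finally show ?thesis by simp
qed

text \<open>The subgradient inequality at a single point of the domain suffices, as the sensitivity there is bounded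
  on the compact set \<open>X\<close>.\<close>

lemma crit_val_bounded_below:
  assumes "A \<in> crit_dom \<Psi>"
  shows "\<exists>b. \<forall>\<eta>\<in>designs X. info m \<eta> \<in> crit_dom \<Psi> \<longrightarrow> b \<le> crit_val (info m \<eta>)"
proof -
  obtain B where B: "\<And>y. y \<in> X \<Longrightarrow> norm (\<psi> A y) \<le> B"
    using bounded_on_compact[OF compact_X continuous_sensitivity_section[OF assms]] by blast
  have "crit_val A - B \<le> crit_val (info m \<eta>)" if \<eta>: "\<eta> \<in> designs X" "info m \<eta> \<in> crit_dom \<Psi>" for \<eta>
  proof -
    have "- B \<le> \<psi> A y" if "y \<in> X" for y using B[OF that] by simp
    then have "- B \<le> (LINT x|\<eta>. \<psi> A x)"
      using \<eta>(1) by (intro prob_space.integral_ge_const prob_space_design[OF \<eta>(1)]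
          sensitivity_design[OF assms] AE_I2) (simp_all add: space_design[OF \<eta>(1)])
    with sensitivity_subgradient[OF assms \<eta>(1)] show ?thesis
      by (simp add: crit_val[OF assms] crit_val[OF \<eta>(2)])
  qed
  then show ?thesis by blast
qed

text \<open>The sensitivity at \<open>y\<close> is the directional derivative towards \<open>m y\<close>, the information matrix of the
  point mass at \<open>y\<close>.\<close>

lemma local_descent:
  assumes A: "A \<in> crit_dom \<Psi>" and y: "y \<in> X" and neg: "\<psi> A y < - c"
  shows "\<forall>\<^sub>F t in at_right 0. \<Psi> (A + t *\<^sub>R (m y - A)) \<le> ereal (crit_val A - c * t)"
proof -
  have d: "dirac_design X y \<in> designs X" using y by (rule dirac_design_in_designs)
  have i: "(LINT x|dirac_design X y. \<psi> A x) = \<psi> A y"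
    using y measurable_on_design[OF continuous_sensitivity_section[OF A] d] by (rule integral_dirac_design)
  have "\<forall>\<^sub>F t in at_right 0. (\<Psi> (A + t *\<^sub>R (m y - A)) - \<Psi> A) / ereal t < ereal (- c)"
    using sensitivity_design(2)[OF A d] neg unfolding i info_dirac[OF y]
    by (intro order_tendstoD(2)) auto
  moreover have "\<forall>\<^sub>F t in at_right (0::real). t > 0" by (simp add: eventually_at_right_less)
  ultimately show ?thesis
  proof eventually_elim
    case (elim t)
    then show ?case
      by (cases "\<Psi> (A + t *\<^sub>R (m y - A))") (auto simp: crit_val[OF A] field_simps divide_ereal_def)
  qed
qed

text \<open>The sensitivity is assumed to be below \<open>-c\<close> only at those points of the segment that lie in the domain, and it
  is part of the conclusion that the segment stays in the domain up to \<open>T\<close>. This matters because the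
  domain need not be open, and nearby starting points in the domain could otherwise admit arbitrarily short
  steps only. The argument takes the largest \<open>s\<close> up to which the estimate persists: it still holds at
  \<open>s\<close> by lower semicontinuity, and if \<open>s < T\<close> then \<open>local_descent\<close> extends it beyond \<open>s\<close>.\<close>

lemma descent_along_segment:
  assumes A: "A \<in> crit_dom \<Psi>" and y: "y \<in> X" and T: "0 \<le> T" "T < 1" and c: "0 < c"
    and neg: "\<And>t. 0 \<le> t \<Longrightarrow> t \<le> T \<Longrightarrow> A + t *\<^sub>R (m y - A) \<in> crit_dom \<Psi> \<Longrightarrow> \<psi> (A + t *\<^sub>R (m y - A)) y < - c"
  shows "\<Psi> (A + T *\<^sub>R (m y - A)) \<le> ereal (crit_val A - c * T)"
proof -
  define L where "L t = A + t *\<^sub>R (m y - A)" for t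
  define S where "S = {t \<in> {0..T}. \<Psi> (L t) \<le> ereal (crit_val A - c * t)}"
  have L_psd: "L t \<in> psd_matrices" if "0 \<le> t" "t \<le> T" for t
    unfolding L_def using that T y m_psd
    by (intro convex_point_on_segment[OF convex_psd_matrices crit_dom_psd[OF A]]) auto
  have S0: "0 \<in> S" using T by (simp add: S_def L_def crit_val[OF A])
  have bdd: "bdd_above S" by (intro bdd_aboveI[of _ T]) (simp add: S_def)
  define s where "s = Sup S"
  have s: "0 \<le> s" unfolding s_def using S0 bdd by (rule cSup_upper)
  have s': "s \<le> T" unfolding s_def using S0 by (intro cSup_least) (auto simp: S_def)
  have sS: "\<Psi> (L s) \<le> ereal (crit_val A - c * s)"
  proof (rule ccontr)
    assume "\<not> ?thesis"
    then have "ereal (crit_val A - c * s) < \<Psi> (L s)" by simp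
    then obtain z where z: "crit_val A - c * s < z" "ereal z < \<Psi> (L s)"
      using ereal_dense2 by (metis less_ereal.simps(1))
    obtain U where U: "open U" "L s \<in> U" "\<And>B. B \<in> U \<Longrightarrow> B \<in> psd_matrices \<Longrightarrow> ereal z < \<Psi> B"
      using superlevel_neighbourhood[OF L_psd[OF s s'] z(2)] by blast
    have "isCont L s" unfolding L_def by (intro continuous_intros)
    then have "(L \<longlongrightarrow> L s) (nhds s)" by (simp add: isCont_def tendsto_at_iff_tendsto_nhds)
    then have "\<forall>\<^sub>F t in nhds s. L t \<in> U" using U(1,2) by (rule topological_tendstoD)
    moreover have "\<forall>\<^sub>F t in nhds s. crit_val A - c * t < z"
      by (rule order_tendstoD(2)[OF _ z(1)]) (intro tendsto_intros filterlim_ident)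
    ultimately have "\<forall>\<^sub>F t in nhds s. L t \<in> U \<and> crit_val A - c * t < z" by (rule eventually_conj)
    then obtain e where e: "e > 0" "\<And>t. dist t s < e \<Longrightarrow> L t \<in> U \<and> crit_val A - c * t < z"
      unfolding eventually_nhds_metric by blast
    obtain t where t: "t \<in> S" "s - e < t"
      using less_cSup_iff[of S "s - e"] S0 bdd e(1) unfolding s_def[symmetric] by auto
    have "t \<le> s" unfolding s_def using t(1) bdd by (rule cSup_upper)
    with t e have "L t \<in> U" "crit_val A - c * t < z" by (auto simp: dist_real_def)
    moreover have "0 \<le> t" "t \<le> T" "\<Psi> (L t) \<le> ereal (crit_val A - c * t)" using t(1) by (auto simp: S_def)
    ultimately have "ereal z < ereal (crit_val A - c * t)" using U(3) L_psd by (meson less_le_trans)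
    with \<open>crit_val A - c * t < z\<close> show False by simp
  qed
  have dom: "L s \<in> crit_dom \<Psi>" using L_psd[OF s s'] sS by (rule crit_domI)
  have "s = T"
  proof (rule ccontr)
    assume "s \<noteq> T"
    with s' have "s < T" by simp
    have "\<forall>\<^sub>F h in at_right 0. \<Psi> (L s + h *\<^sub>R (m y - L s)) \<le> ereal (crit_val (L s) - c * h)"
      using dom y neg[OF s s'] by (intro local_descent) (auto simp: L_def)
    moreover have "\<forall>\<^sub>F h in at_right (0::real). h \<in> {0 <..< T - s}"
      using \<open>s < T\<close> by (intro eventually_at_right_real) simp
    ultimately have "\<forall>\<^sub>F h in at_right 0. \<Psi> (L s + h *\<^sub>R (m y - L s)) \<le> ereal (crit_val (L s) - c * h)
        \<and> h \<in> {0 <..< T - s}"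
      by (rule eventually_conj)
    then obtain h where h: "\<Psi> (L s + h *\<^sub>R (m y - L s)) \<le> ereal (crit_val (L s) - c * h)" "0 < h" "h < T - s"
      using eventually_happens'[OF trivial_limit_at_right_real] by auto
    \<comment> \<open>The segment from \<open>L s\<close> to \<open>m y\<close> is the rest of the original one, so that a step \<open>h\<close> on it is a
      step \<open>h (1 - s)\<close> on the original segment. The latter is shorter, which only helps the estimate.\<close>
    have Ls: "L s + h *\<^sub>R (m y - L s) = L (s + h * (1 - s))" by (simp add: L_def algebra_simps)
    have hs: "0 \<le> h * s" "0 < h * (1 - s)" using h(2) s s' T by auto
    have "crit_val (L s) \<le> crit_val A - c * s" using sS crit_val[OF dom] by simp
    moreover have "c * (h * (1 - s)) \<le> c * h" using hs c by (intro mult_left_mono) (auto simp: algebra_simps)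
    ultimately have "ereal (crit_val (L s) - c * h) \<le> ereal (crit_val A - c * (s + h * (1 - s)))"
      by (simp add: distrib_left)
    with h(1) have "\<Psi> (L (s + h * (1 - s))) \<le> ereal (crit_val A - c * (s + h * (1 - s)))"
      unfolding Ls by (rule order_trans)
    moreover have "s + h * (1 - s) \<le> T" using hs h(3) by (simp add: algebra_simps)
    ultimately have "s + h * (1 - s) \<in> S" using hs s by (simp add: S_def)
    then have "s + h * (1 - s) \<le> s" unfolding s_def using bdd by (rule cSup_upper)
    with hs show False by simp
  qed
  with sS show ?thesis by (simp add: L_def)
qed

section \<open>Cluster points of near-minimizing sequences\<close>

text \<open>The hypothesis \<open>step\<close> says that the next matrix competes, up to a vanishing error, with every point
  of the segment from \<open>Mk k\<close> to \<open>m (x k)\<close>. Negative sensitivity at a cluster point would then make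
  the values drop infinitely often by a fixed amount, contrary to their convergence.\<close>

lemma cluster_point_nonneg_sensitivity:
  fixes Mk :: "nat \<Rightarrow> real^'d^'d" and x :: "nat \<Rightarrow> 'a"
  assumes Mk: "\<And>k. Mk k \<in> info m ` designs X" "\<And>k. Mk k \<in> crit_dom \<Psi>"
    and x: "\<And>k. x k \<in> X" "\<And>k y. y \<in> X \<Longrightarrow> \<psi> (Mk k) (x k) \<le> \<psi> (Mk k) y + \<delta> k"
    and \<delta>: "\<delta> \<longlonglongrightarrow> 0"
    and step: "\<And>k t. 0 \<le> t \<Longrightarrow> t \<le> 1 \<Longrightarrow> \<Psi> (Mk (Suc k)) \<le> \<Psi> (Mk k + t *\<^sub>R (m (x k) - Mk k)) + ereal (e k)"
    and e: "e \<longlonglongrightarrow> 0"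
    and conv: "convergent (\<lambda>k. crit_val (Mk k))"
    and A: "A \<in> psd_matrices"
    and clust: "\<And>U. open U \<Longrightarrow> A \<in> U \<Longrightarrow> \<exists>\<^sub>F k in sequentially. Mk k \<in> U"
  shows "A \<in> crit_dom \<Psi> \<and> (\<forall>y\<in>X. 0 \<le> \<psi> A y)"
proof
  have "Bseq (\<lambda>k. crit_val (Mk k))" using conv by (rule convergent_imp_Bseq)
  then obtain C where C: "\<And>k. norm (crit_val (Mk k)) \<le> C" unfolding Bseq_def by blast
  have "\<Psi> (Mk k) \<le> ereal C" for k using C[of k] by (simp add: crit_val[OF Mk(2)])
  then show dom: "A \<in> crit_dom \<Psi>"
    using A clust Mk(2) crit_dom_psd by (intro limit_in_dom[of A Mk C]) auto
  show "\<forall>y\<in>X. 0 \<le> \<psi> A y"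
  proof (rule ccontr)
    assume "\<not> ?thesis"
    then obtain z where z: "z \<in> X" "\<psi> A z < 0" by force
    \<comment> \<open>The value \<open>-6 c\<close> at \<open>z\<close> loses \<open>c\<close> each by passing from \<open>A\<close> to \<open>Mk k\<close>, by the tolerance in the
      choice of \<open>x k\<close>, by passing back to \<open>A\<close>, and by moving to the points of the segment; this
      leaves \<open>-2 c\<close>, which is strictly below \<open>-c\<close>.\<close>
    define c where "c = - \<psi> A z / 6"
    have c: "0 < c" "\<psi> A z = - 6 * c" using z(2) by (auto simp: c_def)
    \<comment> \<open>Compactness of \<open>X\<close> yields one neighbourhood for all points of \<open>X\<close>, so the points \<open>x k\<close> need not
      converge.\<close>
    obtain V where V: "A \<in> V" "open V"
      and V_close: "\<forall>B\<in>V \<inter> crit_dom \<Psi>. \<forall>y\<in>X. dist (\<psi> B y) (\<psi> A y) \<le> c"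
      using continuous_on_prod_compactE[OF continuous_sensitivity compact_X dom c(1)] by auto
    obtain r where r: "r > 0" "ball A r \<subseteq> V" using V open_contains_ball by blast
    have "bounded (convex hull (m ` X))" using compact_hull by (rule compact_imp_bounded)
    then obtain R where R: "\<And>B. B \<in> convex hull (m ` X) \<Longrightarrow> norm B \<le> R" unfolding bounded_iff by blast
    have diam: "norm (m (x k) - Mk k) \<le> 2 * R" for k
      using norm_triangle_ineq4[of "m (x k)" "Mk k"] R[of "m (x k)"] R[of "Mk k"] Mk(1)[of k] x(1)[of k]
      by (simp add: info_image_eq_hull hull_inc)
    have R0: "0 \<le> R" using diam[of 0] norm_ge_zero[of "m (x 0) - Mk 0"] by linarith
    \<comment> \<open>Starting within \<open>r / 2\<close> of \<open>A\<close>, a segment whose direction has norm at most \<open>2 R\<close> stays in \<open>ball A r\<close> up to \<open>T\<close>.\<close>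
    define T where "T = min (1/2) (r / (2 * (2 * R + 1)))"
    have T: "0 < T" "T < 1" "T * (2 * R) \<le> r / 2"
    proof -
      show "0 < T" "T < 1" using r(1) R0 by (auto simp: T_def)
      have "T * (2 * R) \<le> r / (2 * (2 * R + 1)) * (2 * R + 1)"
        using R0 r(1) \<open>0 < T\<close> by (intro mult_mono) (auto simp: T_def)
      also have "\<dots> = r / 2" using R0 by (simp add: divide_simps)
      finally show "T * (2 * R) \<le> r / 2" .
    qed
    obtain l where l: "(\<lambda>k. crit_val (Mk k)) \<longlonglongrightarrow> l" using conv by (auto simp: convergent_def)
    have "(\<lambda>k. crit_val (Mk k) - crit_val (Mk (Suc k)) + e k) \<longlonglongrightarrow> l - l + 0"
      by (intro tendsto_intros l LIMSEQ_Suc e)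
    then have "\<forall>\<^sub>F k in sequentially. crit_val (Mk k) - crit_val (Mk (Suc k)) + e k < c * T"
      using c T by (intro order_tendstoD(2)) auto
    moreover have "\<forall>\<^sub>F k in sequentially. \<delta> k < c" using \<delta> c(1) by (rule order_tendstoD(2))
    ultimately have "\<forall>\<^sub>F k in sequentially. crit_val (Mk k) - crit_val (Mk (Suc k)) + e k < c * T \<and> \<delta> k < c"
      by (rule eventually_conj)
    moreover have "\<exists>\<^sub>F k in sequentially. Mk k \<in> ball A (r / 2)" using r(1) by (intro clust) auto
    ultimately obtain k where k: "crit_val (Mk k) - crit_val (Mk (Suc k)) + e k < c * T" "\<delta> k < c"
      "Mk k \<in> ball A (r / 2)"
      using frequently_ex[OF frequently_eventually_conj] by blast
    have V_le: "\<bar>\<psi> B y - \<psi> A y\<bar> \<le> c" if "B \<in> ball A r" "B \<in> crit_dom \<Psi>" "y \<in> X" for B y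
      using V_close r(2) that by (auto simp: dist_real_def)
    have "Mk k \<in> ball A r" using k(3) r(1) by auto
    then have "\<bar>\<psi> (Mk k) z - \<psi> A z\<bar> \<le> c" "\<bar>\<psi> (Mk k) (x k) - \<psi> A (x k)\<bar> \<le> c"
      using V_le Mk(2) z(1) x(1) by auto
    with x(2)[OF z(1), of k] k(2) c have xk: "\<psi> A (x k) < - 3 * c" by linarith
    have "\<Psi> (Mk k + T *\<^sub>R (m (x k) - Mk k)) \<le> ereal (crit_val (Mk k) - c * T)"
    proof (rule descent_along_segment[OF Mk(2) x(1) less_imp_le[OF T(1)] T(2) c(1)])
      fix t assume t: "0 \<le> t" "t \<le> T" and d: "Mk k + t *\<^sub>R (m (x k) - Mk k) \<in> crit_dom \<Psi>"
      have "t * norm (m (x k) - Mk k) \<le> T * (2 * R)" using t diam T(1) by (intro mult_mono) auto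
      then have "dist (Mk k) (Mk k + t *\<^sub>R (m (x k) - Mk k)) \<le> r / 2"
        using T(3) t(1) by (simp add: dist_norm)
      then have "Mk k + t *\<^sub>R (m (x k) - Mk k) \<in> ball A r"
        using k(3) dist_triangle[of A "Mk k + t *\<^sub>R (m (x k) - Mk k)" "Mk k"] by simp
      from V_le[OF this d x(1)[of k]] xk c(1) show "\<psi> (Mk k + t *\<^sub>R (m (x k) - Mk k)) (x k) < - c"
        by linarith
    qed
    from add_right_mono[OF this, of "ereal (e k)"]
    have "\<Psi> (Mk k + T *\<^sub>R (m (x k) - Mk k)) + ereal (e k) \<le> ereal (crit_val (Mk k) - c * T + e k)"
      by simp
    with step[of T k] T have "\<Psi> (Mk (Suc k)) \<le> ereal (crit_val (Mk k) - c * T + e k)"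
      by (meson less_imp_le order_trans)
    then have "crit_val (Mk (Suc k)) \<le> crit_val (Mk k) - c * T + e k" by (simp add: crit_val[OF Mk(2)])
    with k(1) show False by linarith
  qed
qed

end

section \<open>Runs of the strict algorithm\<close>

locale strict_algorithm_run = design_problem X m \<Psi> \<psi>
  for X :: "'a::metric_space set" and m :: "'a \<Rightarrow> real^'d^'d" and \<Psi> \<psi> +
  fixes X0 :: "'a set" and exch :: bool and \<delta>u \<delta>l :: "nat \<Rightarrow> real" and K :: "nat set"
    and Xs :: "nat \<Rightarrow> 'a set" and \<xi> :: "nat \<Rightarrow> 'a measure" and x :: "nat \<Rightarrow> 'a"
  assumes fin_X0: "fin_designs \<Psi> m X X0 \<noteq> {}"
    and \<delta>u_nonneg: "\<And>k. 0 \<le> \<delta>u k" and \<delta>u_lim: "\<delta>u \<longlonglongrightarrow> 0" and \<delta>l_lim: "\<delta>l \<longlonglongrightarrow> 0"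
    and run: "strict_run exch \<Psi> \<psi> m X X0 0 \<delta>u \<delta>l K Xs \<xi> x"
    and \<delta>u_summable: "exch \<Longrightarrow> summable \<delta>u"
begin

abbreviation Mk :: "nat \<Rightarrow> real^'d^'d" where "Mk k \<equiv> info m (\<xi> k)"

lemma run_start: "Xs 0 = X0"
  and run_design: "k \<in> K \<Longrightarrow> \<xi> k \<in> designs_in X (Xs k)"
  and run_design_le: "k \<in> K \<Longrightarrow> \<eta> \<in> designs_in X (Xs k) \<Longrightarrow> \<Psi> (Mk k) \<le> \<Psi> (info m \<eta>) + ereal (\<delta>u k)"
  and run_point: "k \<in> K \<Longrightarrow> x k \<in> X"
  and run_point_le: "k \<in> K \<Longrightarrow> y \<in> X \<Longrightarrow> \<psi> (Mk k) (x k) \<le> \<psi> (Mk k) y + \<delta>l k"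
proof -
  show "Xs 0 = X0" using run by (simp add: strict_run_def)
  assume "k \<in> K"
  with run have \<xi>: "\<xi> k \<in> approx_minimizers (\<delta>u k) (\<lambda>\<eta>. \<Psi> (info m \<eta>)) (designs_in X (Xs k))"
    and x: "x k \<in> approx_minimizers (\<delta>l k) (\<lambda>y. ereal (\<psi> (info m (\<xi> k)) y)) X"
    unfolding strict_run_def by blast+
  show "\<xi> k \<in> designs_in X (Xs k)" "x k \<in> X" using \<xi> x by (simp_all add: approx_minimizers_def)
  show "\<eta> \<in> designs_in X (Xs k) \<Longrightarrow> \<Psi> (Mk k) \<le> \<Psi> (info m \<eta>) + ereal (\<delta>u k)"
    using approx_minimizers_le[OF \<xi>] by blast
  show "y \<in> X \<Longrightarrow> \<psi> (Mk k) (x k) \<le> \<psi> (Mk k) y + \<delta>l k"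
    using approx_minimizers_le[OF x, of y] by simp
qed

lemma run_designs: "k \<in> K \<Longrightarrow> \<xi> k \<in> designs X" and run_supp: "k \<in> K \<Longrightarrow> supp (\<xi> k) \<subseteq> Xs k"
  using run_design by (auto simp: designs_in_def)

lemma run_continue:
  assumes "k \<in> K" "Suc k \<in> K"
  shows "Xs (Suc k) = (if exch then supp (\<xi> k) else Xs k) \<union> {x k}"
proof -
  have "if \<psi> (Mk k) (x k) < - 0 + \<delta>l k
      then Suc k \<in> K \<and> Xs (Suc k) = (if exch then supp (\<xi> k) else Xs k) \<union> {x k} else K = {..k}"
    using run assms(1) unfolding strict_run_def by blast
  moreover have "K \<noteq> {..k}" using assms(2) by auto
  ultimately show ?thesis by meson
qed

lemma run_stop: "K = {..n} \<Longrightarrow> \<delta>l n \<le> \<psi> (Mk n) (x n)"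
proof -
  assume K: "K = {..n}"
  then have "n \<in> K" "Suc n \<notin> K" by auto
  with run have "\<not> \<psi> (Mk n) (x n) < - 0 + \<delta>l n" unfolding strict_run_def by meson
  then show ?thesis by simp
qed

lemma run_index_less: "Suc k \<in> K \<Longrightarrow> k \<in> K"
  using run unfolding strict_run_def by auto

lemma supp_subset_next: "k \<in> K \<Longrightarrow> Suc k \<in> K \<Longrightarrow> supp (\<xi> k) \<union> {x k} \<subseteq> Xs (Suc k)"
  using run_continue run_supp by auto

text \<open>Each discretization contains the support of the previous design, so finiteness of the criterion is
  passed on from one iteration to the next.\<close>

lemma run_in_dom: "k \<in> K \<Longrightarrow> Mk k \<in> crit_dom \<Psi>"
proof (induction k)
  case 0
  obtain \<eta> where \<eta>: "\<eta> \<in> designs_in X (Xs 0)" "\<Psi> (info m \<eta>) < \<infinity>"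
    using fin_X0 by (auto simp: fin_designs_def run_start)
  have "\<Psi> (Mk 0) < \<infinity>"
    using run_design_le[OF 0 \<eta>(1)] \<eta>(2) by (cases "\<Psi> (info m \<eta>)") auto
  then show ?case using info_psd[OF run_designs[OF 0]] by (simp add: crit_dom_def)
next
  case (Suc k)
  have k: "k \<in> K" using Suc.prems by (rule run_index_less)
  have "\<xi> k \<in> designs_in X (Xs (Suc k))"
    using supp_subset_next[OF k Suc.prems] run_designs[OF k] by (simp add: designs_in_def)
  from run_design_le[OF Suc.prems this] show ?case
    by (intro crit_domI[where c = "crit_val (Mk k) + \<delta>u (Suc k)"] info_psd run_designs Suc.prems)
      (simp add: crit_val[OF Suc.IH[OF k]])
qed

text \<open>The competitor is the mixture of \<open>\<xi> k\<close> with the point mass at \<open>x k\<close>. It is feasible even under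
  exchange, because the exchange keeps the support of \<open>\<xi> k\<close>.\<close>

lemma run_step:
  assumes k: "k \<in> K" "Suc k \<in> K" and t: "0 \<le> t" "t \<le> 1"
  shows "\<Psi> (Mk (Suc k)) \<le> \<Psi> (Mk k + t *\<^sub>R (m (x k) - Mk k)) + ereal (\<delta>u (Suc k))"
proof -
  define \<eta> where "\<eta> = mixture t (dirac_design X (x k)) (\<xi> k)"
  have d: "dirac_design X (x k) \<in> designs X" using run_point[OF k(1)] by (rule dirac_design_in_designs)
  have t': "t \<in> {0..1}" using t by simp
  have "supp \<eta> \<subseteq> Xs (Suc k)"
    using supp_mixture_subset[OF d run_designs[OF k(1)] t'] supp_dirac_design[of X "x k"]
      supp_subset_next[OF k] unfolding \<eta>_def by blast
  then have "\<eta> \<in> designs_in X (Xs (Suc k))"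
    using mixture_in_designs[OF d run_designs[OF k(1)]] by (simp add: designs_in_def \<eta>_def)
  moreover have "info m \<eta> = Mk k + t *\<^sub>R (m (x k) - Mk k)"
    unfolding \<eta>_def info_mixture[OF d run_designs[OF k(1)] t'] info_dirac[OF run_point[OF k(1)]]
    by (simp add: algebra_simps)
  ultimately show ?thesis using run_design_le[OF k(2)] by metis
qed

text \<open>When the run stops, the approximately minimal sensitivity is at least its own tolerance, so the exact
  minimum is nonnegative.\<close>

lemma stop_at_optimal:
  assumes "K = {..n}" "\<eta> \<in> designs X"
  shows "\<Psi> (Mk n) \<le> \<Psi> (info m \<eta>)"
proof -
  have n: "n \<in> K" using assms(1) by simp
  have "0 \<le> \<psi> (Mk n) y" if "y \<in> X" for y
    using run_point_le[OF n that] run_stop[OF assms(1)] by linarith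
  then show ?thesis by (rule nonneg_sensitivity_imp_minimal[OF run_in_dom[OF n] _ assms(2)])
qed

text \<open>Without exchange the discretizations grow, so each design is feasible in all later problems and later
  values exceed earlier ones by at most the later tolerance. With exchange this is known only for
  consecutive designs, and the errors accumulate; they are summable.\<close>

lemma crit_val_convergent:
  assumes K: "K = UNIV"
  shows "convergent (\<lambda>k. crit_val (Mk k))"
proof -
  have KI: "k \<in> K" for k by (simp add: K)
  obtain b where b: "\<And>k. b \<le> crit_val (Mk k)"
    using crit_val_bounded_below[OF run_in_dom[OF KI[of 0]]] run_in_dom[OF KI] run_designs[OF KI] by blast
  show ?thesis
  proof (cases exch)
    case True
    have "crit_val (Mk (Suc k)) \<le> crit_val (Mk k) + \<delta>u (Suc k)" for k
      using run_step[OF KI[of k] KI, of 0] by (simp add: crit_val[OF run_in_dom[OF KI]])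
    with \<delta>u_summable[OF True] \<delta>u_nonneg b show ?thesis by (intro convergent_summable_increase[where d = \<delta>u])
  next
    case False
    have Suc_sub: "Xs k \<subseteq> Xs (Suc k)" for k using run_continue[OF KI[of k] KI] False by auto
    have "crit_val (Mk j) \<le> crit_val (Mk i) + \<delta>u j" if "i \<le> j" for i j
    proof -
      have "Xs i \<subseteq> Xs j" using that by (rule lift_Suc_mono_le[of Xs, OF Suc_sub])
      then have "\<xi> i \<in> designs_in X (Xs j)"
        using run_design[OF KI[of i]] by (auto simp: designs_in_def)
      from run_design_le[OF KI this] show ?thesis by (simp add: crit_val[OF run_in_dom[OF KI]])
    qed
    then show ?thesis using \<delta>u_lim b by (rule convergent_almost_decreasing)
  qed
qed

lemma cluster_point_minimal:
  assumes K: "K = UNIV" and A: "A \<in> psd_matrices"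
    and clust: "\<And>U. open U \<Longrightarrow> A \<in> U \<Longrightarrow> \<exists>\<^sub>F k in sequentially. Mk k \<in> U"
  shows "A \<in> crit_dom \<Psi>" and "\<eta> \<in> designs X \<Longrightarrow> \<Psi> A \<le> \<Psi> (info m \<eta>)"
proof -
  have KI: "k \<in> K" for k by (simp add: K)
  have "A \<in> crit_dom \<Psi> \<and> (\<forall>y\<in>X. 0 \<le> \<psi> A y)"
  proof (rule cluster_point_nonneg_sensitivity[where Mk = Mk and x = x and \<delta> = \<delta>l
        and e = "\<lambda>k. \<delta>u (Suc k)", OF _ _ _ _ \<delta>l_lim _ _ _ A clust])
    show "Mk k \<in> info m ` designs X" for k using run_designs[OF KI] by blast
    show "(\<lambda>k. \<delta>u (Suc k)) \<longlonglongrightarrow> 0" using \<delta>u_lim by (rule LIMSEQ_Suc)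
  qed (auto intro: run_in_dom[OF KI] run_point[OF KI] run_point_le[OF KI] run_step[OF KI KI]
        crit_val_convergent[OF K])
  then show "A \<in> crit_dom \<Psi>" "\<eta> \<in> designs X \<Longrightarrow> \<Psi> A \<le> \<Psi> (info m \<eta>)"
    using nonneg_sensitivity_imp_minimal by auto
qed

text \<open>All cluster points minimize the criterion over the compact set of information matrices, and by strict
  convexity there is a single minimizer. If the sequence did not converge to it, some cluster point would
  lie outside a neighbourhood of it.\<close>

lemma information_matrices_converge:
  assumes K: "K = UNIV" and strict: "strictly_convex_crit \<Psi>"
  shows "\<exists>A. minimizers \<Psi> (info m ` designs X) = {A} \<and> Mk \<longlonglongrightarrow> A"
proof -
  let ?H = "convex hull (m ` X)"
  have MkH: "Mk k \<in> ?H" for k using run_designs[of k] by (simp add: K info_in_hull)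
  have minimal: "B \<in> crit_dom \<Psi>" "\<And>C. C \<in> ?H \<Longrightarrow> \<Psi> B \<le> \<Psi> C"
    if "B \<in> ?H" "\<And>U. open U \<Longrightarrow> B \<in> U \<Longrightarrow> \<exists>\<^sub>F k in sequentially. Mk k \<in> U" for B
  proof -
    have B: "B \<in> psd_matrices" using that(1) hull_psd by blast
    show "B \<in> crit_dom \<Psi>" by (rule cluster_point_minimal(1)[OF K B that(2)])
    show "\<Psi> B \<le> \<Psi> C" if "C \<in> ?H" for C
      using that cluster_point_minimal(2)[OF K B] \<open>\<And>U. open U \<Longrightarrow> B \<in> U \<Longrightarrow> \<exists>\<^sub>F k in sequentially. Mk k \<in> U\<close>
      unfolding info_image_eq_hull[symmetric] by blast
  qed
  obtain A where A: "A \<in> ?H" "\<And>U. open U \<Longrightarrow> A \<in> U \<Longrightarrow> \<exists>\<^sub>F k in sequentially. Mk k \<in> U"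
    using frequently_in_compact_cluster[OF compact_hull, of Mk]
      eventually_frequently[OF sequentially_bot always_eventually, of "\<lambda>k. Mk k \<in> ?H"] MkH by blast
  have unique: "B = A" if B: "B \<in> ?H" "\<And>C. C \<in> ?H \<Longrightarrow> \<Psi> B \<le> \<Psi> C" for B
  proof (rule ccontr)
    assume "B \<noteq> A"
    have eq: "\<Psi> B = \<Psi> A" using B A(1) minimal(2)[OF A B(1)] by (intro antisym)
    have dom: "A \<in> crit_dom \<Psi>" by (rule minimal(1)[OF A])
    have domB: "B \<in> crit_dom \<Psi>"
      using dom eq B(1) hull_psd by (auto simp: crit_dom_def)
    have half: "(1/2 :: real) \<in> {0<..<1}" by simp
    have "\<Psi> ((1/2) *\<^sub>R B + (1 - 1/2) *\<^sub>R A) < ereal (1/2) * \<Psi> B + ereal (1 - 1/2) * \<Psi> A"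
      using strict dom domB \<open>B \<noteq> A\<close> half unfolding strictly_convex_crit_def by blast
    also have "\<dots> = \<Psi> A" by (simp add: eq crit_val[OF dom])
    finally have "\<Psi> ((1/2) *\<^sub>R B + (1 - 1/2) *\<^sub>R A) < \<Psi> A" .
    moreover have "(1/2) *\<^sub>R B + (1 - 1/2) *\<^sub>R A \<in> ?H"
      using B(1) A(1) by (intro convexD[OF convex_convex_hull]) auto
    ultimately show False using minimal(2)[OF A] by (meson leD)
  qed
  have "B \<in> minimizers \<Psi> ?H \<longleftrightarrow> B = A" for B
    unfolding minimizers_iff using A(1) minimal(2)[OF A] unique by blast
  then have "minimizers \<Psi> (info m ` designs X) = {A}" unfolding info_image_eq_hull by blast
  moreover have "Mk \<longlonglongrightarrow> A"
  proof (rule topological_tendstoI, rule ccontr)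
    fix U assume U: "open U" "A \<in> U" and "\<not> (\<forall>\<^sub>F k in sequentially. Mk k \<in> U)"
    then have "\<exists>\<^sub>F k in sequentially. Mk k \<in> ?H - U" using MkH by (simp add: not_eventually)
    then obtain B where B: "B \<in> ?H - U" "\<And>U. open U \<Longrightarrow> B \<in> U \<Longrightarrow> \<exists>\<^sub>F k in sequentially. Mk k \<in> U"
      using frequently_in_compact_cluster[OF compact_diff[OF compact_hull U(1)], of Mk] by blast
    then have "B = A" using minimal(2)[of B] by (intro unique) auto
    with B(1) U(2) show False by blast
  qed
  ultimately show ?thesis by blast
qed

end

theorem corollary3p15:
  fixes X X0 :: "'a::metric_space set"
    and m :: "'a \<Rightarrow> real^'d^'d"
    and \<Psi> :: "real^'d^'d \<Rightarrow> ereal"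
    and \<psi> :: "real^'d^'d \<Rightarrow> 'a \<Rightarrow> real"
    and exch :: bool
    and \<delta>u \<delta>l :: "nat \<Rightarrow> real"
    and K :: "nat set"
    and Xs :: "nat \<Rightarrow> 'a set"
    and \<xi> :: "nat \<Rightarrow> 'a measure"
    and x :: "nat \<Rightarrow> 'a"
  assumes "compact X"
    and "continuous_on X m" and "m ` X \<subseteq> psd_matrices"
    and "criterion \<Psi>" and "convex_crit \<Psi>" and "lsc_crit \<Psi>"
    and "fin_designs \<Psi> m X X \<noteq> {}"
    and "sensitivity_function \<Psi> m X \<psi>"
    and "continuous_on (crit_dom \<Psi> \<times> X) (\<lambda>(A, y). \<psi> A y)"
    and "finite X0" and "X0 \<subseteq> X" and "fin_designs \<Psi> m X X0 \<noteq> {}"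
    and "\<And>k. 0 \<le> \<delta>u k" and "\<And>k. 0 \<le> \<delta>l k"
    and "\<delta>u \<longlonglongrightarrow> 0" and "\<delta>l \<longlonglongrightarrow> 0"
    and "strict_run exch \<Psi> \<psi> m X X0 0 \<delta>u \<delta>l K Xs \<xi> x"
    and "exch \<Longrightarrow> strictly_convex_crit \<Psi>" and "exch \<Longrightarrow> summable \<delta>u"
  shows "(\<forall>n. K = {..n} \<longrightarrow> \<xi> n \<in> optimal_designs \<Psi> m X) \<and>
    (K = UNIV \<longrightarrow>
       (\<forall>\<xi>'. accumulation_point_in (weak_topology X) \<xi> \<xi>' \<longrightarrow> \<xi>' \<in> optimal_designs \<Psi> m X)) \<and>
    (K = UNIV \<and> strictly_convex_crit \<Psi> \<longrightarrow>
       (\<exists>A. minimizers \<Psi> (info m ` designs X) = {A} \<and> (\<lambda>k. info m (\<xi> k)) \<longlonglongrightarrow> A))"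
proof -
  interpret strict_algorithm_run X m \<Psi> \<psi> X0 exch \<delta>u \<delta>l K Xs \<xi> x
    by unfold_locales (fact assms)+
  have optimalI: "\<eta> \<in> optimal_designs \<Psi> m X"
    if "\<eta> \<in> designs X" "\<And>\<nu>. \<nu> \<in> designs X \<Longrightarrow> \<Psi> (info m \<eta>) \<le> \<Psi> (info m \<nu>)" for \<eta>
    using that by (simp add: optimal_designs_def minimizers_iff)
  show ?thesis
  proof (intro conjI allI impI)
    fix n assume "K = {..n}"
    then show "\<xi> n \<in> optimal_designs \<Psi> m X"
      by (intro optimalI run_designs stop_at_optimal) auto
  next
    fix \<xi>' assume K: "K = UNIV" and acc: "accumulation_point_in (weak_topology X) \<xi> \<xi>'"
    note d = accumulation_point_info(1)[OF acc]
    show "\<xi>' \<in> optimal_designs \<Psi> m X"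
      by (rule optimalI[OF d], rule cluster_point_minimal(2)[OF K info_psd[OF d]])
        (auto intro: accumulation_point_info(2)[OF acc])
  next
    assume "K = UNIV \<and> strictly_convex_crit \<Psi>"
    then show "\<exists>A. minimizers \<Psi> (info m ` designs X) = {A} \<and> (\<lambda>k. info m (\<xi> k)) \<longlonglongrightarrow> A"
      using information_matrices_converge by blast
  qed
qed

end
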